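(* Let $\mathfrak{g}$ be a simple Lie algebra over a field of characteristic $p>0$ such that the outer derivation algebra $\mathrm{Out}(\mathfrak{g})$ is solvable. Then $\mathfrak{g}$ is taut.
   Context: All Lie algebras are finite-dimensional. A simple Lie algebra is a non-abelian Lie algebra with no nontrivial proper ideals. $\mathrm{Der}(\mathfrak{g})$ is the Lie algebra of derivations of $\mathfrak{g}$, $\mathrm{Inn}(\mathfrak{g})$ the ideal of inner derivations, and $\mathrm{Out}(\mathfrak{g})=\mathrm{Der}(\mathfrak{g})/\mathrm{Inn}(\mathfrak{g})$. $\mathfrak{g}$ is called taut if every Lie algebra homomorphism $\varphi\colon\mathfrak{g}\to\mathrm{Der}(\mathfrak{g})$ satisfies $\varphi(\mathfrak{g})\subseteq\mathrm{Inn}(\mathfrak{g})$. *)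

theory Defs
  imports
    "HOL-Algebra.Module"
    "HOL-Algebra.QuotRing"
    "HOL-Algebra.Multiplicative_Group"
begin

text \<open>
  A Lie algebra over a field \<open>R\<close> is carried by a record of type \<^typ>\<open>('a, 'b) module\<close>, as
  associative algebras are in the locale \<^locale>\<open>algebra\<close>: the field \<^const>\<open>monoid.mult\<close> holds the Lie
  bracket. The field \<^const>\<open>monoid.one\<close> has no meaning and is never referred to.
\<close>

locale lie_algebra = module R L + R?: field R for R (structure) and L (structure) +
  assumes bracket_closed [simp, intro]:
      "\<lbrakk>x \<in> carrier L; y \<in> carrier L\<rbrakk> \<Longrightarrow> x \<otimes>\<^bsub>L\<^esub> y \<in> carrier L"
    and bracket_l_distr:
      "\<lbrakk>x \<in> carrier L; y \<in> carrier L; z \<in> carrier L\<rbrakk> \<Longrightarrow>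
        (x \<oplus>\<^bsub>L\<^esub> y) \<otimes>\<^bsub>L\<^esub> z = (x \<otimes>\<^bsub>L\<^esub> z) \<oplus>\<^bsub>L\<^esub> (y \<otimes>\<^bsub>L\<^esub> z)"
    and bracket_r_distr:
      "\<lbrakk>x \<in> carrier L; y \<in> carrier L; z \<in> carrier L\<rbrakk> \<Longrightarrow>
        x \<otimes>\<^bsub>L\<^esub> (y \<oplus>\<^bsub>L\<^esub> z) = (x \<otimes>\<^bsub>L\<^esub> y) \<oplus>\<^bsub>L\<^esub> (x \<otimes>\<^bsub>L\<^esub> z)"
    and bracket_l_smult:
      "\<lbrakk>a \<in> carrier R; x \<in> carrier L; y \<in> carrier L\<rbrakk> \<Longrightarrow>
        (a \<odot>\<^bsub>L\<^esub> x) \<otimes>\<^bsub>L\<^esub> y = a \<odot>\<^bsub>L\<^esub> (x \<otimes>\<^bsub>L\<^esub> y)"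
    and bracket_r_smult:
      "\<lbrakk>a \<in> carrier R; x \<in> carrier L; y \<in> carrier L\<rbrakk> \<Longrightarrow>
        x \<otimes>\<^bsub>L\<^esub> (a \<odot>\<^bsub>L\<^esub> y) = a \<odot>\<^bsub>L\<^esub> (x \<otimes>\<^bsub>L\<^esub> y)"
    and bracket_self [simp]:
      "x \<in> carrier L \<Longrightarrow> x \<otimes>\<^bsub>L\<^esub> x = \<zero>\<^bsub>L\<^esub>"
    and jacobi:
      "\<lbrakk>x \<in> carrier L; y \<in> carrier L; z \<in> carrier L\<rbrakk> \<Longrightarrow>
        x \<otimes>\<^bsub>L\<^esub> (y \<otimes>\<^bsub>L\<^esub> z) \<oplus>\<^bsub>L\<^esub> y \<otimes>\<^bsub>L\<^esub> (z \<otimes>\<^bsub>L\<^esub> x) \<oplus>\<^bsub>L\<^esub> z \<otimes>\<^bsub>L\<^esub> (x \<otimes>\<^bsub>L\<^esub> y) = \<zero>\<^bsub>L\<^esub>"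

definition lin_span :: "('a, 'r) ring_scheme \<Rightarrow> ('a, 'b, 'm) module_scheme \<Rightarrow> 'b set \<Rightarrow> 'b set" where
  "lin_span R L S = (\<lambda>N. submodule N R L) hull S"

definition lie_finite_dim :: "('a, 'r) ring_scheme \<Rightarrow> ('a, 'b, 'm) module_scheme \<Rightarrow> bool" where
  "lie_finite_dim R L \<longleftrightarrow> (\<exists>S. finite S \<and> S \<subseteq> carrier L \<and> lin_span R L S = carrier L)"

text \<open>\<open>group.ord\<close> is \<open>0\<close> on elements of infinite order, so this is \<open>0\<close> in characteristic zero.\<close>

definition ring_char :: "('a, 'r) ring_scheme \<Rightarrow> nat" where
  "ring_char R = group.ord (add_monoid R) \<one>\<^bsub>R\<^esub>"

definition lie_ideal ::
    "'b set \<Rightarrow> ('a, 'r) ring_scheme \<Rightarrow> ('a, 'b, 'm) module_scheme \<Rightarrow> bool" where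
  "lie_ideal I R L \<longleftrightarrow> submodule I R L \<and> (\<forall>x\<in>carrier L. \<forall>y\<in>I. x \<otimes>\<^bsub>L\<^esub> y \<in> I)"

definition lie_abelian :: "('a, 'b, 'm) module_scheme \<Rightarrow> bool" where
  "lie_abelian L \<longleftrightarrow> (\<forall>x\<in>carrier L. \<forall>y\<in>carrier L. x \<otimes>\<^bsub>L\<^esub> y = \<zero>\<^bsub>L\<^esub>)"

definition lie_simple :: "('a, 'r) ring_scheme \<Rightarrow> ('a, 'b, 'm) module_scheme \<Rightarrow> bool" where
  "lie_simple R L \<longleftrightarrow>
    \<not> lie_abelian L \<and> (\<forall>I. lie_ideal I R L \<longrightarrow> I = {\<zero>\<^bsub>L\<^esub>} \<or> I = carrier L)"

definition lie_hom ::
    "('a, 'r) ring_scheme \<Rightarrow> ('a, 'b, 'm) module_scheme \<Rightarrow> ('a, 'c, 'n) module_scheme \<Rightarrow> ('b \<Rightarrow> 'c) set" where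
  "lie_hom R L M =
    {f \<in> carrier L \<rightarrow> carrier M.
      (\<forall>x\<in>carrier L. \<forall>y\<in>carrier L. f (x \<oplus>\<^bsub>L\<^esub> y) = f x \<oplus>\<^bsub>M\<^esub> f y) \<and>
      (\<forall>a\<in>carrier R. \<forall>x\<in>carrier L. f (a \<odot>\<^bsub>L\<^esub> x) = a \<odot>\<^bsub>M\<^esub> f x) \<and>
      (\<forall>x\<in>carrier L. \<forall>y\<in>carrier L. f (x \<otimes>\<^bsub>L\<^esub> y) = f x \<otimes>\<^bsub>M\<^esub> f y)}"

fun lie_derived_series ::
    "('a, 'r) ring_scheme \<Rightarrow> ('a, 'b, 'm) module_scheme \<Rightarrow> nat \<Rightarrow> 'b set" where
  "lie_derived_series R L 0 = carrier L"
| "lie_derived_series R L (Suc n) =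
    lin_span R L {x \<otimes>\<^bsub>L\<^esub> y | x y. x \<in> lie_derived_series R L n \<and> y \<in> lie_derived_series R L n}"

definition lie_solvable :: "('a, 'r) ring_scheme \<Rightarrow> ('a, 'b, 'm) module_scheme \<Rightarrow> bool" where
  "lie_solvable R L \<longleftrightarrow> (\<exists>n. lie_derived_series R L n = {\<zero>\<^bsub>L\<^esub>})"

text \<open>
  A derivation is represented by an extensional function on the carrier, so that equality of
  derivations is equality in HOL.
\<close>

definition lie_derivations ::
    "('a, 'r) ring_scheme \<Rightarrow> ('a, 'b, 'm) module_scheme \<Rightarrow> ('b \<Rightarrow> 'b) set" where
  "lie_derivations R L =
    {D \<in> carrier L \<rightarrow>\<^sub>E carrier L.
      (\<forall>x\<in>carrier L. \<forall>y\<in>carrier L. D (x \<oplus>\<^bsub>L\<^esub> y) = D x \<oplus>\<^bsub>L\<^esub> D y) \<and>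
      (\<forall>a\<in>carrier R. \<forall>x\<in>carrier L. D (a \<odot>\<^bsub>L\<^esub> x) = a \<odot>\<^bsub>L\<^esub> D x) \<and>
      (\<forall>x\<in>carrier L. \<forall>y\<in>carrier L. D (x \<otimes>\<^bsub>L\<^esub> y) = (D x \<otimes>\<^bsub>L\<^esub> y) \<oplus>\<^bsub>L\<^esub> (x \<otimes>\<^bsub>L\<^esub> D y))}"

definition lie_Der ::
    "('a, 'r) ring_scheme \<Rightarrow> ('a, 'b, 'm) module_scheme \<Rightarrow> ('a, 'b \<Rightarrow> 'b) module" where
  "lie_Der R L =
    \<lparr>carrier = lie_derivations R L,
     mult = (\<lambda>D E. \<lambda>x\<in>carrier L. D (E x) \<ominus>\<^bsub>L\<^esub> E (D x)),
     one = undefined,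
     zero = (\<lambda>x\<in>carrier L. \<zero>\<^bsub>L\<^esub>),
     add = (\<lambda>D E. \<lambda>x\<in>carrier L. D x \<oplus>\<^bsub>L\<^esub> E x),
     smult = (\<lambda>a D. \<lambda>x\<in>carrier L. a \<odot>\<^bsub>L\<^esub> D x)\<rparr>"

definition lie_ad :: "('a, 'b, 'm) module_scheme \<Rightarrow> 'b \<Rightarrow> 'b \<Rightarrow> 'b" where
  "lie_ad L x = (\<lambda>y\<in>carrier L. x \<otimes>\<^bsub>L\<^esub> y)"

definition lie_Inn :: "('a, 'b, 'm) module_scheme \<Rightarrow> ('b \<Rightarrow> 'b) set" where
  "lie_Inn L = lie_ad L ` carrier L"

definition lie_quotient ::
    "('a, 'b, 'm) module_scheme \<Rightarrow> 'b set \<Rightarrow> ('a, 'b set) module" where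
  "lie_quotient L I =
    \<lparr>carrier = a_rcosets\<^bsub>L\<^esub> I,
     mult = rcoset_mult L I,
     one = undefined,
     zero = I,
     add = set_add L,
     smult = (\<lambda>a X. \<Union>x\<in>X. I +>\<^bsub>L\<^esub> (a \<odot>\<^bsub>L\<^esub> x))\<rparr>"

definition lie_Out ::
    "('a, 'r) ring_scheme \<Rightarrow> ('a, 'b, 'm) module_scheme \<Rightarrow> ('a, ('b \<Rightarrow> 'b) set) module" where
  "lie_Out R L = lie_quotient (lie_Der R L) (lie_Inn L)"

definition lie_taut :: "('a, 'r) ring_scheme \<Rightarrow> ('a, 'b, 'm) module_scheme \<Rightarrow> bool" where
  "lie_taut R L \<longleftrightarrow> (\<forall>\<phi>\<in>lie_hom R L (lie_Der R L). \<phi> ` carrier L \<subseteq> lie_Inn L)"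

text \<open>
  Well-definedness: \<open>Der\<close> is a Lie algebra, \<open>Inn\<close> is an ideal of it, and the quotient by an ideal
  (in particular \<open>Out\<close>) is a Lie algebra, whose operations do not depend on representatives.
\<close>

context lie_algebra begin

lemma bracket_r_zero [simp]: "x \<in> carrier L \<Longrightarrow> x \<otimes>\<^bsub>L\<^esub> \<zero>\<^bsub>L\<^esub> = \<zero>\<^bsub>L\<^esub>"
  using bracket_r_smult[of \<zero> x "\<zero>\<^bsub>L\<^esub>"] by simp

lemma bracket_l_zero [simp]: "x \<in> carrier L \<Longrightarrow> \<zero>\<^bsub>L\<^esub> \<otimes>\<^bsub>L\<^esub> x = \<zero>\<^bsub>L\<^esub>"
  using bracket_l_smult[of \<zero> "\<zero>\<^bsub>L\<^esub>" x] by simp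

lemma bracket_r_minus: "\<lbrakk>x \<in> carrier L; y \<in> carrier L\<rbrakk> \<Longrightarrow> x \<otimes>\<^bsub>L\<^esub> (\<ominus>\<^bsub>L\<^esub> y) = \<ominus>\<^bsub>L\<^esub> (x \<otimes>\<^bsub>L\<^esub> y)"
  by (metis M.add.inv_closed M.add.inv_equality M.l_neg bracket_closed bracket_r_distr bracket_r_zero)

lemma bracket_l_minus: "\<lbrakk>x \<in> carrier L; y \<in> carrier L\<rbrakk> \<Longrightarrow> (\<ominus>\<^bsub>L\<^esub> x) \<otimes>\<^bsub>L\<^esub> y = \<ominus>\<^bsub>L\<^esub> (x \<otimes>\<^bsub>L\<^esub> y)"
  by (metis M.add.inv_closed M.add.inv_equality M.l_neg bracket_closed bracket_l_distr bracket_l_zero)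

lemma bracket_anticomm:
  assumes "x \<in> carrier L" "y \<in> carrier L"
  shows "y \<otimes>\<^bsub>L\<^esub> x = \<ominus>\<^bsub>L\<^esub> (x \<otimes>\<^bsub>L\<^esub> y)"
proof -
  have "(x \<oplus>\<^bsub>L\<^esub> y) \<otimes>\<^bsub>L\<^esub> (x \<oplus>\<^bsub>L\<^esub> y) = \<zero>\<^bsub>L\<^esub>"
    using assms by simp
  then have "y \<otimes>\<^bsub>L\<^esub> x \<oplus>\<^bsub>L\<^esub> x \<otimes>\<^bsub>L\<^esub> y = \<zero>\<^bsub>L\<^esub>"
    using assms bracket_self[of x] bracket_self[of y]
    by (simp add: bracket_l_distr bracket_r_distr M.a_comm del: bracket_self)
  then show ?thesis
    using assms by (simp add: M.minus_equality)
qed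

lemma derD:
  assumes "D \<in> lie_derivations R L"
  shows "x \<in> carrier L \<Longrightarrow> D x \<in> carrier L"
    and "\<lbrakk>x \<in> carrier L; y \<in> carrier L\<rbrakk> \<Longrightarrow> D (x \<oplus>\<^bsub>L\<^esub> y) = D x \<oplus>\<^bsub>L\<^esub> D y"
    and "\<lbrakk>a \<in> carrier R; x \<in> carrier L\<rbrakk> \<Longrightarrow> D (a \<odot>\<^bsub>L\<^esub> x) = a \<odot>\<^bsub>L\<^esub> D x"
    and "\<lbrakk>x \<in> carrier L; y \<in> carrier L\<rbrakk> \<Longrightarrow>
          D (x \<otimes>\<^bsub>L\<^esub> y) = (D x \<otimes>\<^bsub>L\<^esub> y) \<oplus>\<^bsub>L\<^esub> (x \<otimes>\<^bsub>L\<^esub> D y)"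
    and "D \<in> extensional (carrier L)"
  using assms by (auto simp: lie_derivations_def PiE_def)

lemma der_zero: "D \<in> lie_derivations R L \<Longrightarrow> D \<zero>\<^bsub>L\<^esub> = \<zero>\<^bsub>L\<^esub>"
  using derD(3)[of D \<zero> "\<zero>\<^bsub>L\<^esub>"] derD(1)[of D "\<zero>\<^bsub>L\<^esub>"] by simp

lemma der_minus: "\<lbrakk>D \<in> lie_derivations R L; x \<in> carrier L\<rbrakk> \<Longrightarrow> D (\<ominus>\<^bsub>L\<^esub> x) = \<ominus>\<^bsub>L\<^esub> D x"
  by (metis M.add.inv_closed M.add.inv_equality M.l_neg der_zero derD(1,2))

lemma der_diff: "\<lbrakk>D \<in> lie_derivations R L; x \<in> carrier L; y \<in> carrier L\<rbrakk>
  \<Longrightarrow> D (x \<ominus>\<^bsub>L\<^esub> y) = D x \<ominus>\<^bsub>L\<^esub> D y"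
  by (simp add: a_minus_def derD der_minus)

lemma derI:
  assumes "\<And>x. x \<in> carrier L \<Longrightarrow> f x \<in> carrier L"
    and "\<And>x y. \<lbrakk>x \<in> carrier L; y \<in> carrier L\<rbrakk> \<Longrightarrow> f (x \<oplus>\<^bsub>L\<^esub> y) = f x \<oplus>\<^bsub>L\<^esub> f y"
    and "\<And>a x. \<lbrakk>a \<in> carrier R; x \<in> carrier L\<rbrakk> \<Longrightarrow> f (a \<odot>\<^bsub>L\<^esub> x) = a \<odot>\<^bsub>L\<^esub> f x"
    and "\<And>x y. \<lbrakk>x \<in> carrier L; y \<in> carrier L\<rbrakk> \<Longrightarrow>
          f (x \<otimes>\<^bsub>L\<^esub> y) = (f x \<otimes>\<^bsub>L\<^esub> y) \<oplus>\<^bsub>L\<^esub> (x \<otimes>\<^bsub>L\<^esub> f y)"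
  shows "(\<lambda>x\<in>carrier L. f x) \<in> lie_derivations R L"
  using assms by (auto simp: lie_derivations_def)

lemma lie_Der_sel [simp]:
  "carrier (lie_Der R L) = lie_derivations R L"
  "D \<otimes>\<^bsub>lie_Der R L\<^esub> E = (\<lambda>x\<in>carrier L. D (E x) \<ominus>\<^bsub>L\<^esub> E (D x))"
  "\<zero>\<^bsub>lie_Der R L\<^esub> = (\<lambda>x\<in>carrier L. \<zero>\<^bsub>L\<^esub>)"
  "D \<oplus>\<^bsub>lie_Der R L\<^esub> E = (\<lambda>x\<in>carrier L. D x \<oplus>\<^bsub>L\<^esub> E x)"
  "a \<odot>\<^bsub>lie_Der R L\<^esub> D = (\<lambda>x\<in>carrier L. a \<odot>\<^bsub>L\<^esub> D x)"
  by (simp_all add: lie_Der_def)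

lemma der_add_closed:
  assumes "D \<in> lie_derivations R L" "E \<in> lie_derivations R L"
  shows "(\<lambda>x\<in>carrier L. D x \<oplus>\<^bsub>L\<^esub> E x) \<in> lie_derivations R L"
  by (rule derI) (simp_all add: derD[OF assms(1)] derD[OF assms(2)] M.a_ac smult_r_distr
      bracket_l_distr bracket_r_distr)

lemma der_smult_closed:
  assumes "a \<in> carrier R" "D \<in> lie_derivations R L"
  shows "(\<lambda>x\<in>carrier L. a \<odot>\<^bsub>L\<^esub> D x) \<in> lie_derivations R L"
  by (rule derI) (simp_all add: assms(1) derD[OF assms(2)] smult_r_distr bracket_l_smult
      bracket_r_smult smult_assoc1[symmetric] R.m_comm)

lemma der_zero_closed: "(\<lambda>x\<in>carrier L. \<zero>\<^bsub>L\<^esub>) \<in> lie_derivations R L"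
  by (rule derI) simp_all

lemma der_bracket_leibniz_aux:
  assumes "a \<in> carrier L" "b \<in> carrier L" "c \<in> carrier L" "d \<in> carrier L" "e \<in> carrier L" "f \<in> carrier L"
  shows "a \<oplus>\<^bsub>L\<^esub> b \<oplus>\<^bsub>L\<^esub> (c \<oplus>\<^bsub>L\<^esub> d) \<ominus>\<^bsub>L\<^esub> (e \<oplus>\<^bsub>L\<^esub> c \<oplus>\<^bsub>L\<^esub> (b \<oplus>\<^bsub>L\<^esub> f)) = a \<ominus>\<^bsub>L\<^esub> e \<oplus>\<^bsub>L\<^esub> (d \<ominus>\<^bsub>L\<^esub> f)"
proof -
  have "a \<ominus>\<^bsub>L\<^esub> e \<oplus>\<^bsub>L\<^esub> (d \<ominus>\<^bsub>L\<^esub> f) = a \<ominus>\<^bsub>L\<^esub> e \<oplus>\<^bsub>L\<^esub> (d \<ominus>\<^bsub>L\<^esub> f) \<oplus>\<^bsub>L\<^esub> ((b \<oplus>\<^bsub>L\<^esub> c) \<oplus>\<^bsub>L\<^esub> \<ominus>\<^bsub>L\<^esub> (b \<oplus>\<^bsub>L\<^esub> c))"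
    using assms by (simp add: M.r_neg)
  also have "\<dots> = a \<oplus>\<^bsub>L\<^esub> b \<oplus>\<^bsub>L\<^esub> (c \<oplus>\<^bsub>L\<^esub> d) \<ominus>\<^bsub>L\<^esub> (e \<oplus>\<^bsub>L\<^esub> c \<oplus>\<^bsub>L\<^esub> (b \<oplus>\<^bsub>L\<^esub> f))"
    using assms by (simp add: a_minus_def M.minus_add M.a_ac)
  finally show ?thesis by simp
qed

lemma der_jacobi_aux:
  assumes "a \<in> carrier L" "b \<in> carrier L" "c \<in> carrier L" "d \<in> carrier L" "e \<in> carrier L" "f \<in> carrier L"
  shows "((a \<ominus>\<^bsub>L\<^esub> b) \<ominus>\<^bsub>L\<^esub> (c \<ominus>\<^bsub>L\<^esub> d)) \<oplus>\<^bsub>L\<^esub> ((c \<ominus>\<^bsub>L\<^esub> e) \<ominus>\<^bsub>L\<^esub> (f \<ominus>\<^bsub>L\<^esub> b)) \<oplus>\<^bsub>L\<^esub> ((f \<ominus>\<^bsub>L\<^esub> d) \<ominus>\<^bsub>L\<^esub> (a \<ominus>\<^bsub>L\<^esub> e)) = \<zero>\<^bsub>L\<^esub>"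
proof -
  let ?S = "a \<oplus>\<^bsub>L\<^esub> b \<oplus>\<^bsub>L\<^esub> c \<oplus>\<^bsub>L\<^esub> d \<oplus>\<^bsub>L\<^esub> e \<oplus>\<^bsub>L\<^esub> f"
  have "?S \<oplus>\<^bsub>L\<^esub> \<ominus>\<^bsub>L\<^esub> ?S = \<zero>\<^bsub>L\<^esub>"
    using assms by (simp add: M.r_neg)
  then show ?thesis
    using assms by (simp add: a_minus_def M.minus_add M.a_ac)
qed

lemma der_bracket_closed:
  assumes D: "D \<in> lie_derivations R L" and E: "E \<in> lie_derivations R L"
  shows "(\<lambda>x\<in>carrier L. D (E x) \<ominus>\<^bsub>L\<^esub> E (D x)) \<in> lie_derivations R L"
proof (rule derI)
  note d = derD[OF D] derD[OF E]
  show "D (E x) \<ominus>\<^bsub>L\<^esub> E (D x) \<in> carrier L" if "x \<in> carrier L" for x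
    using that by (simp add: d)
  show "D (E (x \<oplus>\<^bsub>L\<^esub> y)) \<ominus>\<^bsub>L\<^esub> E (D (x \<oplus>\<^bsub>L\<^esub> y)) =
       D (E x) \<ominus>\<^bsub>L\<^esub> E (D x) \<oplus>\<^bsub>L\<^esub> (D (E y) \<ominus>\<^bsub>L\<^esub> E (D y))"
    if "x \<in> carrier L" "y \<in> carrier L" for x y
    using that by (simp add: d a_minus_def M.minus_add M.a_ac)
  show "D (E (a \<odot>\<^bsub>L\<^esub> x)) \<ominus>\<^bsub>L\<^esub> E (D (a \<odot>\<^bsub>L\<^esub> x)) = a \<odot>\<^bsub>L\<^esub> (D (E x) \<ominus>\<^bsub>L\<^esub> E (D x))"
    if "a \<in> carrier R" "x \<in> carrier L" for a x
    using that by (simp add: d a_minus_def smult_r_distr smult_r_minus)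
  show "D (E (x \<otimes>\<^bsub>L\<^esub> y)) \<ominus>\<^bsub>L\<^esub> E (D (x \<otimes>\<^bsub>L\<^esub> y)) =
       (D (E x) \<ominus>\<^bsub>L\<^esub> E (D x)) \<otimes>\<^bsub>L\<^esub> y \<oplus>\<^bsub>L\<^esub> x \<otimes>\<^bsub>L\<^esub> (D (E y) \<ominus>\<^bsub>L\<^esub> E (D y))"
    if "x \<in> carrier L" "y \<in> carrier L" for x y
  proof -
    have "D (E (x \<otimes>\<^bsub>L\<^esub> y)) \<ominus>\<^bsub>L\<^esub> E (D (x \<otimes>\<^bsub>L\<^esub> y)) =
      (D (E x) \<otimes>\<^bsub>L\<^esub> y) \<ominus>\<^bsub>L\<^esub> (E (D x) \<otimes>\<^bsub>L\<^esub> y) \<oplus>\<^bsub>L\<^esub> ((x \<otimes>\<^bsub>L\<^esub> D (E y)) \<ominus>\<^bsub>L\<^esub> (x \<otimes>\<^bsub>L\<^esub> E (D y)))"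
      using that by (simp add: d der_bracket_leibniz_aux)
    also have "\<dots> = (D (E x) \<ominus>\<^bsub>L\<^esub> E (D x)) \<otimes>\<^bsub>L\<^esub> y \<oplus>\<^bsub>L\<^esub> x \<otimes>\<^bsub>L\<^esub> (D (E y) \<ominus>\<^bsub>L\<^esub> E (D y))"
      using that by (simp add: d a_minus_def bracket_l_distr bracket_r_distr bracket_l_minus bracket_r_minus)
    finally show ?thesis .
  qed
qed

lemma der_eqI:
  assumes "D \<in> lie_derivations R L" "E \<in> lie_derivations R L"
    and "\<And>x. x \<in> carrier L \<Longrightarrow> D x = E x"
  shows "D = E"
  using assms derD(5) by (metis extensionalityI)

lemma der_abelian_group: "abelian_group (lie_Der R L)"
proof (rule abelian_groupI)
  fix D assume D: "D \<in> carrier (lie_Der R L)"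
  show "\<exists>E\<in>carrier (lie_Der R L). E \<oplus>\<^bsub>lie_Der R L\<^esub> D = \<zero>\<^bsub>lie_Der R L\<^esub>"
  proof
    show "(\<lambda>x\<in>carrier L. \<ominus> \<one> \<odot>\<^bsub>L\<^esub> D x) \<in> carrier (lie_Der R L)"
      using D by (auto intro: der_smult_closed)
    show "(\<lambda>x\<in>carrier L. \<ominus> \<one> \<odot>\<^bsub>L\<^esub> D x) \<oplus>\<^bsub>lie_Der R L\<^esub> D = \<zero>\<^bsub>lie_Der R L\<^esub>"
      using D by (auto intro!: restrict_ext simp: smult_l_minus derD M.l_neg)
  qed
  show "\<zero>\<^bsub>lie_Der R L\<^esub> \<oplus>\<^bsub>lie_Der R L\<^esub> D = D"
    using D by (auto intro!: extensionalityI[of _ "carrier L"] simp: derD)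
qed (auto intro!: der_add_closed der_zero_closed restrict_ext simp: derD M.a_ac)

lemma der_module: "module R (lie_Der R L)"
proof (rule moduleI)
  fix D assume D: "D \<in> carrier (lie_Der R L)"
  show "\<one> \<odot>\<^bsub>lie_Der R L\<^esub> D = D"
    by (rule der_eqI) (use D in \<open>auto intro: der_smult_closed simp: derD\<close>)
qed (auto intro!: R.is_cring der_abelian_group der_smult_closed restrict_ext
      simp: derD smult_l_distr smult_r_distr smult_assoc1)

lemma lie_algebra_Der: "lie_algebra R (lie_Der R L)"
proof (intro lie_algebra.intro der_module lie_algebra_axioms.intro)
  show "field R" by (rule R.field_axioms)
  fix D E F assume "D \<in> carrier (lie_Der R L)" "E \<in> carrier (lie_Der R L)" "F \<in> carrier (lie_Der R L)"
  then have d: "D \<in> lie_derivations R L" "E \<in> lie_derivations R L" "F \<in> lie_derivations R L" by simp_all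
  note d' = derD[OF d(1)] derD[OF d(2)] derD[OF d(3)]
  show "D \<otimes>\<^bsub>lie_Der R L\<^esub> (E \<otimes>\<^bsub>lie_Der R L\<^esub> F) \<oplus>\<^bsub>lie_Der R L\<^esub>
       E \<otimes>\<^bsub>lie_Der R L\<^esub> (F \<otimes>\<^bsub>lie_Der R L\<^esub> D) \<oplus>\<^bsub>lie_Der R L\<^esub>
       F \<otimes>\<^bsub>lie_Der R L\<^esub> (D \<otimes>\<^bsub>lie_Der R L\<^esub> E) =  \<zero>\<^bsub>lie_Der R L\<^esub>"
    by (auto intro!: restrict_ext simp: d' d der_diff der_jacobi_aux)
qed (auto intro!: der_bracket_closed[unfolded a_minus_def] restrict_ext
      simp: derD der_minus a_minus_def M.minus_add M.a_ac M.r_neg smult_r_distr smult_r_minus)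

lemma minus_zeroD: "\<lbrakk>x \<ominus>\<^bsub>L\<^esub> y = \<zero>\<^bsub>L\<^esub>; x \<in> carrier L; y \<in> carrier L\<rbrakk> \<Longrightarrow> x = y"
  by (metis M.a_inv_closed M.minus_equality M.minus_minus a_minus_def)

lemma der_sub_inn:
  assumes x: "x \<in> carrier L"
  shows "lie_ad L x \<in> lie_derivations R L"
  unfolding lie_ad_def
proof (rule derI)
  fix u v assume uv: "u \<in> carrier L" "v \<in> carrier L"
  have "x \<otimes>\<^bsub>L\<^esub> (u \<otimes>\<^bsub>L\<^esub> v) \<oplus>\<^bsub>L\<^esub> \<ominus>\<^bsub>L\<^esub> (u \<otimes>\<^bsub>L\<^esub> (x \<otimes>\<^bsub>L\<^esub> v)) \<oplus>\<^bsub>L\<^esub> \<ominus>\<^bsub>L\<^esub> ((x \<otimes>\<^bsub>L\<^esub> u) \<otimes>\<^bsub>L\<^esub> v) = \<zero>\<^bsub>L\<^esub>"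
    using jacobi[of x u v] bracket_anticomm[of x v] bracket_anticomm[of "x \<otimes>\<^bsub>L\<^esub> u" v] x uv
    by (simp add: bracket_r_minus)
  then have "x \<otimes>\<^bsub>L\<^esub> (u \<otimes>\<^bsub>L\<^esub> v) \<ominus>\<^bsub>L\<^esub> ((x \<otimes>\<^bsub>L\<^esub> u) \<otimes>\<^bsub>L\<^esub> v \<oplus>\<^bsub>L\<^esub> u \<otimes>\<^bsub>L\<^esub> (x \<otimes>\<^bsub>L\<^esub> v)) = \<zero>\<^bsub>L\<^esub>"
    using x uv by (simp add: a_minus_def M.minus_add M.a_ac)
  then show "x \<otimes>\<^bsub>L\<^esub> (u \<otimes>\<^bsub>L\<^esub> v) = ((x \<otimes>\<^bsub>L\<^esub> u) \<otimes>\<^bsub>L\<^esub> v) \<oplus>\<^bsub>L\<^esub> (u \<otimes>\<^bsub>L\<^esub> (x \<otimes>\<^bsub>L\<^esub> v))"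
    by (rule minus_zeroD) (use x uv in simp_all)
qed (use x in \<open>simp_all add: bracket_r_distr bracket_r_smult\<close>)

lemma lie_ideal_Inn: "lie_ideal (lie_Inn L) R (lie_Der R L)"
proof -
  have sub: "submodule (lie_Inn L) R (lie_Der R L)"
  proof (rule module.submoduleI[OF der_module])
    show "lie_Inn L \<subseteq> carrier (lie_Der R L)"
      by (auto simp: lie_Inn_def der_sub_inn)
    show "\<zero>\<^bsub>lie_Der R L\<^esub> \<in> lie_Inn L"
      unfolding lie_Inn_def by (rule image_eqI[of _ _ "\<zero>\<^bsub>L\<^esub>"]) (auto simp: lie_ad_def intro!: restrict_ext)
    interpret Der: abelian_group "lie_Der R L" by (rule der_abelian_group)
    show "\<ominus>\<^bsub>lie_Der R L\<^esub> a \<in> lie_Inn L" if "a \<in> lie_Inn L" for a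
    proof -
      from that obtain x where x: "x \<in> carrier L" "a = lie_ad L x" by (auto simp: lie_Inn_def)
      have "\<ominus>\<^bsub>lie_Der R L\<^esub> a = lie_ad L (\<ominus>\<^bsub>L\<^esub> x)"
        apply (rule Der.minus_equality)
        using x  der_sub_inn[of x] der_sub_inn[of "\<ominus>\<^bsub>L\<^esub> x"]
          apply (auto simp: lie_ad_def bracket_l_minus M.l_neg intro!: restrict_ext)
        done
      then show ?thesis using x by (auto simp: lie_Inn_def)
    qed
    show "a \<oplus>\<^bsub>lie_Der R L\<^esub> b \<in> lie_Inn L" if ab: "a \<in> lie_Inn L" "b \<in> lie_Inn L" for a b
    proof -
      from ab obtain x y where x: "x \<in> carrier L" "a = lie_ad L x" "y \<in> carrier L" "b = lie_ad L y" 
        by (auto simp: lie_Inn_def)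
      then have "a \<oplus>\<^bsub>lie_Der R L\<^esub> b = lie_ad L (x \<oplus>\<^bsub>L\<^esub> y)"
        by (auto simp: lie_ad_def bracket_l_distr intro!: restrict_ext)
      then show ?thesis using x by (auto simp: lie_Inn_def)
    qed
    show "a \<odot>\<^bsub>lie_Der R L\<^esub> b \<in> lie_Inn L" if ab: "a \<in> carrier R" "b \<in> lie_Inn L" for a b
    proof -
      from ab obtain y where x: "y \<in> carrier L" "b = lie_ad L y" 
        by (auto simp: lie_Inn_def)
      then have "a \<odot>\<^bsub>lie_Der R L\<^esub> b = lie_ad L (a \<odot>\<^bsub>L\<^esub> y)" using ab
        by (auto simp: lie_ad_def bracket_l_smult intro!: restrict_ext)
      then show ?thesis using x ab by (auto simp: lie_Inn_def)
    qed
  qed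
  have "D \<otimes>\<^bsub>lie_Der R L\<^esub> a \<in> lie_Inn L" if ab: "D \<in> carrier (lie_Der R L)" "a \<in> lie_Inn L" for D a
  proof -
      from ab obtain x where x: "x \<in> carrier L" "a = lie_ad L x" by (auto simp: lie_Inn_def)
      have D: "D \<in> lie_derivations R L" using ab by simp
      have "D \<otimes>\<^bsub>lie_Der R L\<^esub> a = lie_ad L (D x)"
        using x by (auto simp: lie_ad_def derD[OF D] a_minus_def M.a_assoc M.r_neg intro!: restrict_ext)
      then show ?thesis using x D by (auto simp: lie_Inn_def derD)
  qed
  with sub show ?thesis by (auto simp: lie_ideal_def)
qed

lemma lie_algebra_quotient:
  assumes I: "lie_ideal I R L"
  shows "lie_algebra R (lie_quotient L I)"
proof -
  have sm: "submodule I R L" and ib: "\<And>x y. x \<in> carrier L \<Longrightarrow> y \<in> I \<Longrightarrow> x \<otimes>\<^bsub>L\<^esub> y \<in> I"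
    using I by (auto simp: lie_ideal_def)
  interpret I: submodule I R L by (rule sm)
  interpret A: abelian_subgroup I L
    by (intro abelian_subgroupI3 additive_subgroup.intro I.subgroup_axioms M.abelian_group_axioms)
  have sub: "\<And>x. x \<in> I \<Longrightarrow> x \<in> carrier L" by (rule A.a_Hcarr)
  have ibl: "y \<otimes>\<^bsub>L\<^esub> x \<in> I" if "x \<in> carrier L" "y \<in> I" for x y
    using that ib[OF that] bracket_anticomm[of x y] sub[of y] by (simp add: A.a_inv_closed)
  let ?Q = "lie_quotient L I"
  have sel: "carrier ?Q = a_rcosets\<^bsub>L\<^esub> I" "\<zero>\<^bsub>?Q\<^esub> = I" "add ?Q = set_add L"
    by (simp_all add: lie_quotient_def)
  have rep: "\<exists>x\<in>carrier L. X = I +>\<^bsub>L\<^esub> x" if "X \<in> carrier ?Q" for X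
    using that by (auto simp: sel A_RCOSETS_def RCOSETS_def a_r_coset_def)
  have cl: "I +>\<^bsub>L\<^esub> x \<in> carrier ?Q" if "x \<in> carrier L" for x
    using that by (auto simp: sel A_RCOSETS_def RCOSETS_def a_r_coset_def)
  have eqI: "I +>\<^bsub>L\<^esub> x = I +>\<^bsub>L\<^esub> y" if "x = h \<oplus>\<^bsub>L\<^esub> y" "h \<in> I" "y \<in> carrier L" for x y h
    using that A.a_repr_independence'[of x y] by (auto simp: a_r_coset_def r_coset_def)
  have mem: "\<exists>h\<in>I. x' = h \<oplus>\<^bsub>L\<^esub> x" if "x' \<in> I +>\<^bsub>L\<^esub> x" for x x'
    using that by (auto simp: a_r_coset_def r_coset_def)
  have add: "(I +>\<^bsub>L\<^esub> x) \<oplus>\<^bsub>?Q\<^esub> (I +>\<^bsub>L\<^esub> y) = I +>\<^bsub>L\<^esub> (x \<oplus>\<^bsub>L\<^esub> y)" if "x \<in> carrier L" "y \<in> carrier L" for x y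
    using that by (simp add: sel A.a_rcos_sum)
  have sml: "a \<odot>\<^bsub>?Q\<^esub> (I +>\<^bsub>L\<^esub> x) = I +>\<^bsub>L\<^esub> (a \<odot>\<^bsub>L\<^esub> x)" if "a \<in> carrier R" "x \<in> carrier L" for a x
  proof -
    have eq: "I +>\<^bsub>L\<^esub> (a \<odot>\<^bsub>L\<^esub> x') = I +>\<^bsub>L\<^esub> (a \<odot>\<^bsub>L\<^esub> x)" if "x' \<in> I +>\<^bsub>L\<^esub> x" for x'
    proof -
      from mem[OF that] obtain h where h: "h \<in> I" "x' = h \<oplus>\<^bsub>L\<^esub> x" by blast
      show ?thesis by (rule eqI[of _ "a \<odot>\<^bsub>L\<^esub> h"]) (use h \<open>a \<in> _\<close> \<open>x \<in> _\<close> in \<open>auto simp: smult_r_distr sub I.smult_closed\<close>)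
    qed
    have self: "x \<in> I +>\<^bsub>L\<^esub> x" using that by (simp add: A.a_rcos_self)
    show ?thesis
      unfolding lie_quotient_def module.simps
      by (rule SUP_eq_const) (use self in blast, rule eq)
  qed
  have brk: "(I +>\<^bsub>L\<^esub> x) \<otimes>\<^bsub>?Q\<^esub> (I +>\<^bsub>L\<^esub> y) = I +>\<^bsub>L\<^esub> (x \<otimes>\<^bsub>L\<^esub> y)" if xy: "x \<in> carrier L" "y \<in> carrier L" for x y
  proof -
    have eq: "I +>\<^bsub>L\<^esub> (x' \<otimes>\<^bsub>L\<^esub> y') = I +>\<^bsub>L\<^esub> (x \<otimes>\<^bsub>L\<^esub> y)" if "x' \<in> I +>\<^bsub>L\<^esub> x" "y' \<in> I +>\<^bsub>L\<^esub> y" for x' y'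
    proof -
      from mem[OF that(1)] obtain h where h: "h \<in> I" "x' = h \<oplus>\<^bsub>L\<^esub> x" by blast
      from mem[OF that(2)] obtain k where k: "k \<in> I" "y' = k \<oplus>\<^bsub>L\<^esub> y" by blast
      show ?thesis
        by (rule eqI[of _ "(h \<otimes>\<^bsub>L\<^esub> k \<oplus>\<^bsub>L\<^esub> h \<otimes>\<^bsub>L\<^esub> y) \<oplus>\<^bsub>L\<^esub> x \<otimes>\<^bsub>L\<^esub> k"])
          (use h k xy in \<open>auto simp: bracket_l_distr bracket_r_distr M.a_ac sub ib ibl A.a_closed\<close>)
    qed
    have self: "x \<in> I +>\<^bsub>L\<^esub> x" "y \<in> I +>\<^bsub>L\<^esub> y" using xy by (simp_all add: A.a_rcos_self)
    show ?thesis
      unfolding lie_quotient_def monoid.simps rcoset_mult_def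
      by (rule SUP_eq_const, use self in blast, rule SUP_eq_const, use self in blast, rule eq)
  qed
  have zero: "\<zero>\<^bsub>?Q\<^esub> = I +>\<^bsub>L\<^esub> \<zero>\<^bsub>L\<^esub>"
    by (simp add: sel M.a_coset_add_zero A.a_subset)
  note q = add sml brk cl
  have ag: "abelian_group ?Q"
  proof (rule abelian_groupI)
    show "\<exists>Y\<in>carrier ?Q. Y \<oplus>\<^bsub>?Q\<^esub> X = \<zero>\<^bsub>?Q\<^esub>" if X: "X \<in> carrier ?Q" for X
    proof -
      obtain x where x: "x \<in> carrier L" "X = I +>\<^bsub>L\<^esub> x" using rep[OF X] by blast
      then show ?thesis by (intro bexI[of _ "I +>\<^bsub>L\<^esub> (\<ominus>\<^bsub>L\<^esub> x)"]) (simp_all add: zero q M.l_neg)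
    qed
  qed (auto dest!: rep simp: zero q M.a_ac)
  have m: "module R ?Q"
    by (rule moduleI; (rule R.is_cring ag)?)
      (auto dest!: rep simp: q smult_l_distr smult_r_distr smult_assoc1)
  show ?thesis
    by (intro lie_algebra.intro m R.field_axioms lie_algebra_axioms.intro)
      (auto dest!: rep simp: zero q jacobi bracket_l_distr bracket_r_distr bracket_l_smult bracket_r_smult)
qed

end

lemma lie_algebra_Out:
  assumes "lie_algebra R L"
  shows "lie_algebra R (lie_Out R L)"
  unfolding lie_Out_def
  using lie_algebra.lie_algebra_quotient[OF lie_algebra.lie_algebra_Der lie_algebra.lie_ideal_Inn] assms by blast

end

theory Submission
  imports Defs
begin

text \<open>
  A simple Lie algebra is perfect, so its image under a homomorphism lies in every term of the derived
  series of the target. Composing \<open>\<phi>\<close> with the projection onto \<open>Out\<close> therefore gives the zero map.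
\<close>

text \<open>Needed because \<open>lin_span\<close> is a hull, that is, an intersection of
  submodules. Nonemptiness keeps the intersection inside the carrier: the empty one would be the
  whole type.\<close>

lemma (in module) submodule_Inter:
  assumes "\<And>N. N \<in> \<N> \<Longrightarrow> submodule N R M" and "\<N> \<noteq> {}"
  shows "submodule (\<Inter>\<N>) R M"
proof (rule submoduleI)
  show "\<Inter>\<N> \<subseteq> carrier M"
    using assms submoduleE(1) by fast
  show "\<zero>\<^bsub>M\<^esub> \<in> \<Inter>\<N>"
    using assms(1) by (simp add: submodule_def subgroup.one_closed[of _ "add_monoid M", simplified])
  show "\<ominus>\<^bsub>M\<^esub> x \<in> \<Inter>\<N>" if "x \<in> \<Inter>\<N>" for x
    using assms(1) submoduleE(3) that by blast
  show "x \<oplus>\<^bsub>M\<^esub> y \<in> \<Inter>\<N>" if "x \<in> \<Inter>\<N>" "y \<in> \<Inter>\<N>" for x y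
    using assms(1) submoduleE(5) that by blast
  show "a \<odot>\<^bsub>M\<^esub> x \<in> \<Inter>\<N>" if "a \<in> carrier R" "x \<in> \<Inter>\<N>" for a x
    using assms(1) submoduleE(4) that by blast
qed

text \<open>The assumption on \<open>S\<close> makes the carrier one of the submodules intersected,
  so the family is nonempty.\<close>

lemma (in module) submodule_lin_span:
  assumes "S \<subseteq> carrier M"
  shows "submodule (lin_span R M S) R M"
  unfolding lin_span_def hull_def
  by (rule submodule_Inter) (use assms carrier_is_submodule in auto)

lemma lin_span_superset: "S \<subseteq> lin_span R M S"
  unfolding lin_span_def by (rule hull_subset)

lemma bracket_in_derived_series:
  assumes "x \<in> lie_derived_series R M n" "y \<in> lie_derived_series R M n"
  shows "x \<otimes>\<^bsub>M\<^esub> y \<in> lie_derived_series R M (Suc n)"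
  unfolding lie_derived_series.simps using assms
  by (intro subsetD[OF lin_span_superset]) blast

lemma lin_span_minimal: "\<lbrakk>S \<subseteq> N; submodule N R M\<rbrakk> \<Longrightarrow> lin_span R M S \<subseteq> N"
  unfolding lin_span_def by (rule hull_minimal)

context lie_algebra
begin

text \<open>Induction is needed only to keep each term inside the carrier, so that the brackets
  spanning the next term lie there too.\<close>

lemma submodule_derived_series: "submodule (lie_derived_series R L n) R L"
proof (induction n)
  case 0
  show ?case
    by (simp add: carrier_is_submodule)
next
  case (Suc n)
  show ?case
    using submoduleE(1)[OF Suc] by (auto intro!: submodule_lin_span)
qed

lemma lie_ideal_derived: "lie_ideal (lie_derived_series R L 1) R L"
proof -
  have "x \<otimes>\<^bsub>L\<^esub> y \<in> lie_derived_series R L 1"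
    if "x \<in> carrier L" "y \<in> lie_derived_series R L 1" for x y
  proof -
    have "y \<in> carrier L"
      using that(2) submoduleE(1)[OF submodule_derived_series] by blast
    with that(1) show ?thesis
      using bracket_in_derived_series[of x R L 0 y] by simp
  qed
  then show ?thesis
    unfolding lie_ideal_def using submodule_derived_series by blast
qed

text \<open>A nonzero bracket exists since the algebra is not abelian. It lies in the derived ideal,
  which is therefore not zero and must be everything.\<close>

lemma lie_simple_imp_perfect:
  assumes "lie_simple R L"
  shows "lie_derived_series R L 1 = carrier L"
proof -
  obtain x y where xy: "x \<in> carrier L" "y \<in> carrier L" "x \<otimes>\<^bsub>L\<^esub> y \<noteq> \<zero>\<^bsub>L\<^esub>"
    using assms by (auto simp: lie_simple_def lie_abelian_def)
  then have "x \<otimes>\<^bsub>L\<^esub> y \<in> lie_derived_series R L 1"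
    using bracket_in_derived_series[of x R L 0 y] by simp
  then show ?thesis
    using assms lie_ideal_derived xy(3) unfolding lie_simple_def by blast
qed

text \<open>This lets a containment of images that is checked on brackets alone pass to their linear
  span.\<close>

lemma submodule_vimage_lie_hom:
  assumes "lie_algebra R M" and f: "f \<in> lie_hom R L M" and N: "submodule N R M"
  shows "submodule {x \<in> carrier L. f x \<in> N} R L"
proof -
  interpret M: lie_algebra R M by fact
  have f_smult: "f (a \<odot>\<^bsub>L\<^esub> x) = a \<odot>\<^bsub>M\<^esub> f x" if "a \<in> carrier R" "x \<in> carrier L" for a x
    using f that by (simp add: lie_hom_def)
  have f_add: "f (x \<oplus>\<^bsub>L\<^esub> y) = f x \<oplus>\<^bsub>M\<^esub> f y" if "x \<in> carrier L" "y \<in> carrier L" for x y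
    using f that by (simp add: lie_hom_def)
  have f_closed: "f x \<in> carrier M" if "x \<in> carrier L" for x
    using f that by (auto simp: lie_hom_def)
  \<comment> \<open>Zero and negatives are handled through linearity, with the scalars
    \<open>0\<close> and \<open>-1\<close>.\<close>
  have f_zero: "f \<zero>\<^bsub>L\<^esub> = \<zero>\<^bsub>M\<^esub>"
    using f_smult[of \<zero> "\<zero>\<^bsub>L\<^esub>"] f_closed by simp
  have f_minus: "f (\<ominus>\<^bsub>L\<^esub> x) = \<ominus>\<^bsub>M\<^esub> f x" if "x \<in> carrier L" for x
    using f_smult[of "\<ominus> \<one>" x] f_closed that by (simp add: smult_l_minus M.smult_l_minus)
  show ?thesis
  proof (rule submoduleI)
    show "\<zero>\<^bsub>L\<^esub> \<in> {x \<in> carrier L. f x \<in> N}"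
      using N by (simp add: f_zero submodule_def subgroup.one_closed[of _ "add_monoid M", simplified])
  qed (use M.submoduleE(3-5)[OF N] in \<open>auto simp: f_add f_smult f_minus\<close>)
qed

text \<open>If all images lie in term \<open>n\<close>, then the image of a bracket, being a bracket
  of images, lies in term \<open>Suc n\<close>. The preimage of that term is a submodule containing
  all brackets, hence their span, which is the whole algebra by perfectness.\<close>

lemma perfect_lie_hom_derived_series:
  assumes perfect: "lie_derived_series R L 1 = carrier L"
    and M: "lie_algebra R M" and f: "f \<in> lie_hom R L M"
  shows "f ` carrier L \<subseteq> lie_derived_series R M n"
proof (induction n)
  case 0
  show ?case
    using f by (auto simp: lie_hom_def)
next
  case (Suc n)
  let ?N = "lie_derived_series R M (Suc n)"
  have "f (x \<otimes>\<^bsub>L\<^esub> y) \<in> ?N" if "x \<in> carrier L" "y \<in> carrier L" for x y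
  proof -
    have "f (x \<otimes>\<^bsub>L\<^esub> y) = f x \<otimes>\<^bsub>M\<^esub> f y"
      using f that by (simp add: lie_hom_def)
    with Suc that show ?thesis
      by (simp only:) (intro bracket_in_derived_series; blast)
  qed
  then have "lie_derived_series R L 1 \<subseteq> {x \<in> carrier L. f x \<in> ?N}"
    unfolding One_nat_def lie_derived_series.simps(2)[of R L]
    by (intro lin_span_minimal submodule_vimage_lie_hom[OF M f]
        lie_algebra.submodule_derived_series[OF M]) auto
  then show ?case
    using perfect by blast
qed

text \<open>Scalar multiplication and bracket of the quotient are unions over representatives. Each
  reduces to a single coset once all representatives are shown to give the same one and the index
  sets are nonempty.\<close>

lemma lie_hom_quotient:
  assumes I: "lie_ideal I R L"
  shows "(\<lambda>x. I +>\<^bsub>L\<^esub> x) \<in> lie_hom R L (lie_quotient L I)"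
proof -
  have sm: "submodule I R L" and ib: "\<And>x y. \<lbrakk>x \<in> carrier L; y \<in> I\<rbrakk> \<Longrightarrow> x \<otimes>\<^bsub>L\<^esub> y \<in> I"
    using I by (auto simp: lie_ideal_def)
  interpret I: submodule I R L by (rule sm)
  interpret A: abelian_subgroup I L
    by (intro abelian_subgroupI3 additive_subgroup.intro I.subgroup_axioms M.abelian_group_axioms)
  have sub: "x \<in> carrier L" if "x \<in> I" for x
    using that by (rule A.a_Hcarr)
  \<comment> \<open>\<open>lie_ideal\<close> states absorption on one side only; anticommutativity
    gives the other.\<close>
  have ibl: "y \<otimes>\<^bsub>L\<^esub> x \<in> I" if "x \<in> carrier L" "y \<in> I" for x y
    using that ib[OF that] bracket_anticomm[of x y] sub[of y] by (simp add: A.a_inv_closed)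
  have coset_eq: "I +>\<^bsub>L\<^esub> x = I +>\<^bsub>L\<^esub> y" if "x = h \<oplus>\<^bsub>L\<^esub> y" "h \<in> I" "y \<in> carrier L" for x y h
    using that A.a_repr_independence'[of x y] by (auto simp: a_r_coset_def r_coset_def)
  have mem: "\<exists>h\<in>I. x' = h \<oplus>\<^bsub>L\<^esub> x" if "x' \<in> I +>\<^bsub>L\<^esub> x" for x x'
    using that by (auto simp: a_r_coset_def r_coset_def)
  have closed: "I +>\<^bsub>L\<^esub> x \<in> carrier (lie_quotient L I)" if "x \<in> carrier L" for x
    using that by (simp add: lie_quotient_def M.a_rcosetsI A.a_subset)
  have add: "I +>\<^bsub>L\<^esub> (x \<oplus>\<^bsub>L\<^esub> y) = (I +>\<^bsub>L\<^esub> x) \<oplus>\<^bsub>lie_quotient L I\<^esub> (I +>\<^bsub>L\<^esub> y)"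
    if "x \<in> carrier L" "y \<in> carrier L" for x y
    using that by (simp add: lie_quotient_def A.a_rcos_sum)
  have smult: "I +>\<^bsub>L\<^esub> (a \<odot>\<^bsub>L\<^esub> x) = a \<odot>\<^bsub>lie_quotient L I\<^esub> (I +>\<^bsub>L\<^esub> x)"
    if ax: "a \<in> carrier R" "x \<in> carrier L" for a x
  proof -
    have "I +>\<^bsub>L\<^esub> (a \<odot>\<^bsub>L\<^esub> x') = I +>\<^bsub>L\<^esub> (a \<odot>\<^bsub>L\<^esub> x)" if "x' \<in> I +>\<^bsub>L\<^esub> x" for x'
    proof -
      from mem[OF that] obtain h where "h \<in> I" "x' = h \<oplus>\<^bsub>L\<^esub> x" by blast
      with ax show ?thesis
        by (intro coset_eq[of _ "a \<odot>\<^bsub>L\<^esub> h"]) (auto simp: smult_r_distr sub I.smult_closed)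
    qed
    then show ?thesis
      unfolding lie_quotient_def module.simps
      by (intro SUP_eq_const[symmetric]) (use A.a_rcos_self[OF ax(2)] in blast)+
  qed
  have bracket: "I +>\<^bsub>L\<^esub> (x \<otimes>\<^bsub>L\<^esub> y) = (I +>\<^bsub>L\<^esub> x) \<otimes>\<^bsub>lie_quotient L I\<^esub> (I +>\<^bsub>L\<^esub> y)"
    if xy: "x \<in> carrier L" "y \<in> carrier L" for x y
  proof -
    have "I +>\<^bsub>L\<^esub> (x' \<otimes>\<^bsub>L\<^esub> y') = I +>\<^bsub>L\<^esub> (x \<otimes>\<^bsub>L\<^esub> y)" if "x' \<in> I +>\<^bsub>L\<^esub> x" "y' \<in> I +>\<^bsub>L\<^esub> y" for x' y'
    proof -
      from mem[OF that(1)] mem[OF that(2)] obtain h k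
        where "h \<in> I" "x' = h \<oplus>\<^bsub>L\<^esub> x" "k \<in> I" "y' = k \<oplus>\<^bsub>L\<^esub> y" by blast
      with xy show ?thesis
        \<comment> \<open>Expanding \<open>[h + x, k + y]\<close> leaves \<open>[x, y]\<close> plus
          the three terms of the witness, each having a factor in \<open>I\<close>.\<close>
        by (intro coset_eq[of _ "(h \<otimes>\<^bsub>L\<^esub> k \<oplus>\<^bsub>L\<^esub> h \<otimes>\<^bsub>L\<^esub> y) \<oplus>\<^bsub>L\<^esub> x \<otimes>\<^bsub>L\<^esub> k"])
          (auto simp: bracket_l_distr bracket_r_distr M.a_ac sub ib ibl A.a_closed)
    qed
    then show ?thesis
      unfolding lie_quotient_def monoid.simps rcoset_mult_def
      using A.a_rcos_self[OF xy(1)] A.a_rcos_self[OF xy(2)]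
      by (intro SUP_eq_const[symmetric] SUP_eq_const) blast+
  qed
  show ?thesis
    using smult bracket add closed by (simp add: lie_hom_def)
qed

end

lemma lie_hom_compose:
  assumes "f \<in> lie_hom R L M" "g \<in> lie_hom R M N"
  shows "g \<circ> f \<in> lie_hom R L N"
  using assms by (auto simp: lie_hom_def Pi_iff)

theorem proposition4p3:
  fixes R :: "('a, 'r) ring_scheme"
    and L :: "('a, 'b, 'm) module_scheme"
    and p :: nat
  assumes "lie_algebra R L"
    and "lie_finite_dim R L"
    and "lie_simple R L"
    and "ring_char R = p" and "p > 0"
    and "lie_solvable R (lie_Out R L)"
  shows "lie_taut R L"
  unfolding lie_taut_def
proof (intro ballI subsetI)
  interpret lie_algebra R L by fact
  interpret Der: lie_algebra R "lie_Der R L" by (rule lie_algebra_Der)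
  interpret Inn: submodule "lie_Inn L" R "lie_Der R L"
    using lie_ideal_Inn by (simp add: lie_ideal_def)
  \<comment> \<open>Supplies the coset facts for inner derivations, in particular that a derivation
    belongs to its own coset.\<close>
  interpret Inn: abelian_subgroup "lie_Inn L" "lie_Der R L"
    by (intro abelian_subgroupI3 additive_subgroup.intro Inn.subgroup_axioms
        Der.M.abelian_group_axioms)
  fix \<phi> D assume \<phi>: "\<phi> \<in> lie_hom R L (lie_Der R L)" and "D \<in> \<phi> ` carrier L"
  then obtain x where x: "x \<in> carrier L" "D = \<phi> x"
    by blast
  have D: "D \<in> carrier (lie_Der R L)"
    using \<phi> x by (auto simp: lie_hom_def)
  obtain n where n: "lie_derived_series R (lie_Out R L) n = {\<zero>\<^bsub>lie_Out R L\<^esub>}"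
    using assms(6) by (auto simp: lie_solvable_def)
  have "(\<lambda>D. lie_Inn L +>\<^bsub>lie_Der R L\<^esub> D) \<circ> \<phi> \<in> lie_hom R L (lie_Out R L)"
    unfolding lie_Out_def by (rule lie_hom_compose[OF \<phi> Der.lie_hom_quotient[OF lie_ideal_Inn]])
  \<comment> \<open>Perfectness puts the image of the composite into every term of the derived
    series of \<open>Out\<close>; solvability makes term \<open>n\<close> zero.\<close>
  from perfect_lie_hom_derived_series[OF lie_simple_imp_perfect[OF assms(3)]
      lie_algebra_Out[OF assms(1)] this]
  have "((\<lambda>D. lie_Inn L +>\<^bsub>lie_Der R L\<^esub> D) \<circ> \<phi>) x \<in> {\<zero>\<^bsub>lie_Out R L\<^esub>}"
    unfolding n[symmetric] using x(1) by blast
  \<comment> \<open>The zero of \<open>Out\<close> is the set of inner derivations itself, so the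
    coset of \<open>D\<close> equals that set and \<open>D\<close>, as a member of its coset, is
    inner.\<close>
  then have "lie_Inn L +>\<^bsub>lie_Der R L\<^esub> D = lie_Inn L"
    unfolding lie_Out_def lie_quotient_def x(2) by simp
  then show "D \<in> lie_Inn L"
    using Inn.a_rcos_self[OF D] by simp
qed

end
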